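(* Let $\Omega$ be a nonempty closed subset of $\mathbb{R}^n$, let $I=\{1,\ldots,m\}$, $J=\{1,\ldots,p\}$, and let $f_i:\mathbb{R}^n\to\mathbb{R}$ ($i\in I$) and $g_j:\mathbb{R}^n\to\mathbb{R}$ ($j\in J$) be lower semicontinuous functions that are Lipschitz at infinity. Let $f=(f_1,\ldots,f_m)$ and $\mathcal{F}=\{x\in\Omega: g_j(x)\le 0,\ j\in J\}$. Assume that $\mathcal{F}$ is nonempty and unbounded and that $\max_{i\in I}f_i$ is bounded from below on $\mathcal{F}$. Assume that the set of Pareto values of the vector optimization problem $\mathrm{Min}_{\mathbb{R}^m_+}\{f(x): x\in\mathcal{F}\}$ is nonempty. If the constraint qualification (CQ) holds at infinity, i.e. there do not exist $\beta_j\ge 0$, $j\in J$, such that $\sum_{j\in J}\beta_j>0$ and $0\in\sum_{j\in J}\beta_j\partial g_j(\infty)+N_\Omega(\infty)$, and if $$0\notin\mathrm{co}\,\{\partial f_1(\infty),\ldots,\partial f_m(\infty)\}+\mathrm{pos}\,\{\partial g_1(\infty),\ldots,\partial g_p(\infty)\}+N_\Omega(\infty),$$ then the set of Pareto solutions of this problem is nonempty and bounded.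
   Context: $\mathbb{R}^n$ carries the Euclidean inner product and norm; $\mathbb{B}_R$ is the closed ball of radius $R$ centered at the origin; $\mathrm{epi}\, h=\{(x,\alpha)\in\mathbb{R}^n\times\mathbb{R}:\alpha\ge h(x)\}$; $\mathbb{R}^m_+$ is the nonnegative orthant of $\mathbb{R}^m$. Sums and scalar multiples of sets are in the Minkowski sense. $\mathrm{co}\,\{D_1,\ldots,D_m\}$ denotes the convex hull of $D_1\cup\cdots\cup D_m$, and $\mathrm{pos}\,\{D_1,\ldots,D_p\}=\{\sum_{j=1}^p\beta_jv_j:\beta_j\ge 0,\ v_j\in D_j,\ j=1,\ldots,p\}$. A point $y\in\mathrm{cl}\, f(\mathcal{F})$ (closure in $\mathbb{R}^m$) is a Pareto value of the problem $\mathrm{Min}_{\mathbb{R}^m_+}\{f(x):x\in\mathcal{F}\}$ if $f(\mathcal{F})\cap\big(y-(\mathbb{R}^m_+\setminus\{0\})\big)=\emptyset$. A point $\bar x\in\mathcal{F}$ is a Pareto solution if $f(\bar x)$ is a Pareto value. A lower semicontinuous function $h:\mathbb{R}^n\to\mathbb{R}$ is Lipschitz at infinity if there exist $L>0$, $R>0$ with $|h(x)-h(x')|\le L\|x-x'\|$ for all $x,x'\in\mathbb{R}^n\setminus\mathbb{B}_R$. For a set $D\subset\mathbb{R}^d$ and $\bar x\in D$, the Fréchet normal cone is $\widehat N_D(\bar x)=\{v\in\mathbb{R}^d:\limsup_{x\to\bar x,\,x\in D}\langle v,x-\bar x\rangle/\|x-\bar x\|\le 0\}$, and the limiting (Mordukhovich)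 normal cone $N_D(\bar x)$ is the set of all $v$ for which there exist $x_k\in D$, $x_k\to\bar x$, and $v_k\in\widehat N_D(x_k)$ with $v_k\to v$. Normal cone at infinity: for an unbounded closed set $\Omega\subset\mathbb{R}^n$, $N_\Omega(\infty)$ is the set of all $v\in\mathbb{R}^n$ for which there exist $x_k\in\Omega$ with $\|x_k\|\to\infty$ and $v_k\in\widehat N_\Omega(x_k)$ with $v_k\to v$. Limiting subdifferential at infinity: for a lower semicontinuous $h:\mathbb{R}^n\to\mathbb{R}$, $\partial h(\infty)$ is the set of all $u\in\mathbb{R}^n$ for which there exist $x_k\in\mathbb{R}^n$ with $\|x_k\|\to\infty$ and $w_k\in N_{\mathrm{epi}\, h}(x_k,h(x_k))$ with $w_k\to(u,-1)$. *)

theory Defs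
  imports "HOL-Analysis.Analysis"
begin

text \<open>
  Sums of sets, including finite sums over index sets, are Minkowski sums
  (from Set-Algebras); the empty sum of sets is the singleton of the origin.
\<close>

definition lower_semicontinuous :: "('a::topological_space \<Rightarrow> real) \<Rightarrow> bool"
  where "lower_semicontinuous h \<longleftrightarrow> (\<forall>x. \<forall>a < h x. \<forall>\<^sub>F y in nhds x. a < h y)"

definition lipschitz_at_infinity :: "('a::real_normed_vector \<Rightarrow> real) \<Rightarrow> bool"
  where "lipschitz_at_infinity h \<longleftrightarrow>
    (\<exists>L>0. \<exists>R>0. \<forall>x \<in> - cball 0 R. \<forall>x' \<in> - cball 0 R. \<bar>h x - h x'\<bar> \<le> L * norm (x - x'))"

text \<open>
  The limes superior runs over points of \<open>D\<close> other than the base point \<open>x\<close>.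
  At an isolated point of \<open>D\<close> the filter is trivial, the limes superior is \<open>-\<infinity>\<close>,
  and the cone is the whole space. The definition is only meant for \<open>x \<in> D\<close>.
\<close>

definition frechet_normal_cone :: "'a::real_inner set \<Rightarrow> 'a \<Rightarrow> 'a set"
  where "frechet_normal_cone D x =
    {v. Limsup (at x within D) (\<lambda>y. ereal (inner v (y - x) / norm (y - x))) \<le> 0}"

definition limiting_normal_cone :: "'a::real_inner set \<Rightarrow> 'a \<Rightarrow> 'a set"
  where "limiting_normal_cone D x =
    {v. \<exists>(xs :: nat \<Rightarrow> 'a) vs.
          (\<forall>k. xs k \<in> D) \<and> xs \<longlonglongrightarrow> x \<and>
          (\<forall>k. vs k \<in> frechet_normal_cone D (xs k)) \<and> vs \<longlonglongrightarrow> v}"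

definition normal_cone_at_infinity :: "'a::real_inner set \<Rightarrow> 'a set"
  where "normal_cone_at_infinity D =
    {v. \<exists>(xs :: nat \<Rightarrow> 'a) vs.
          (\<forall>k. xs k \<in> D) \<and> filterlim (\<lambda>k. norm (xs k)) at_top sequentially \<and>
          (\<forall>k. vs k \<in> frechet_normal_cone D (xs k)) \<and> vs \<longlonglongrightarrow> v}"

definition subdifferential_at_infinity :: "('a::real_inner \<Rightarrow> real) \<Rightarrow> 'a set"
  where "subdifferential_at_infinity h =
    {u. \<exists>(xs :: nat \<Rightarrow> 'a) ws.
          filterlim (\<lambda>k. norm (xs k)) at_top sequentially \<and>
          (\<forall>k. ws k \<in> limiting_normal_cone (epigraph UNIV h) (xs k, h (xs k))) \<and>
          ws \<longlonglongrightarrow> (u, -1)}"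

text \<open>
  One vector is chosen from each \<open>D j\<close>, so this is not the convex cone generated by
  the union: it is empty as soon as some \<open>D j\<close> is empty.
\<close>

definition pos_comb :: "'j set \<Rightarrow> ('j \<Rightarrow> 'a::real_vector set) \<Rightarrow> 'a set"
  where "pos_comb J D =
    {(\<Sum>j\<in>J. \<beta> j *\<^sub>R v j) |\<beta> v. \<forall>j\<in>J. 0 \<le> \<beta> j \<and> v j \<in> D j}"

definition nonneg_orthant :: "(real ^ 'm) set"
  where "nonneg_orthant = {z. \<forall>i. 0 \<le> z $ i}"

definition pareto_values :: "('a \<Rightarrow> real ^ 'm) \<Rightarrow> 'a set \<Rightarrow> (real ^ 'm) set"
  where "pareto_values f F =
    {y \<in> closure (f ` F). f ` F \<inter> (\<lambda>z. y - z) ` (nonneg_orthant - {0}) = {}}"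

definition pareto_solutions :: "('a \<Rightarrow> real ^ 'm) \<Rightarrow> 'a set \<Rightarrow> 'a set"
  where "pareto_solutions f F = {x \<in> F. f x \<in> pareto_values f F}"

definition feasible_set :: "'a set \<Rightarrow> 'j set \<Rightarrow> ('j \<Rightarrow> 'a \<Rightarrow> real) \<Rightarrow> 'a set"
  where "feasible_set \<Omega> J g = {x \<in> \<Omega>. \<forall>j\<in>J. g j x \<le> 0}"

definition CQ_at_infinity :: "'a::real_inner set \<Rightarrow> 'j set \<Rightarrow> ('j \<Rightarrow> 'a \<Rightarrow> real) \<Rightarrow> bool"
  where "CQ_at_infinity \<Omega> J g \<longleftrightarrow>
    \<not> (\<exists>\<beta> :: 'j \<Rightarrow> real. (\<forall>j\<in>J. 0 \<le> \<beta> j) \<and> (\<Sum>j\<in>J. \<beta> j) > 0 \<and>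
        0 \<in> (\<Sum>j\<in>J. (\<lambda>v. \<beta> j *\<^sub>R v) ` subdifferential_at_infinity (g j))
             + normal_cone_at_infinity \<Omega>)"

end

theory Submission
  imports Defs
begin

text \<open>
  Write \<open>F\<close> for the feasible set. Everything follows from one fact: far out in \<open>F\<close> no point
  can be even an almost minimiser of any shifted maximum \<open>MAX i. f i x - c i\<close>
  (\<open>no_far_almost_minimisers\<close>). More precisely, there are \<open>R\<close> and \<open>e > 0\<close> such that whenever this
  function is nonnegative on \<open>F\<close> and at most \<open>e\<close> at \<open>x \<in> F\<close>, then \<open>norm x \<le> R\<close>.
  A Pareto solution \<open>x\<close> satisfies the premises with \<open>c i = f i x\<close>, since no feasible point can be
  strictly better in all components; so the Pareto solutions are bounded. A Pareto value \<open>y\<close> makes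
  \<open>MAX i. f i x - y $ i\<close> nonnegative on \<open>F\<close> for the same reason, and \<open>y\<close> is a limit of values
  \<open>f (x k)\<close> with \<open>x k \<in> F\<close>. Eventually \<open>x k\<close> lies in the ball of radius \<open>R\<close>, a subsequence
  converges, and by lower semicontinuity its limit is feasible and has a value dominating, hence
  equal to, \<open>y\<close>.

  The fact itself is proved by contradiction. The constraints \<open>g j \<le> 0\<close> are absorbed into the
  maximum: if \<open>f i - c i\<close> has nonnegative maximum on \<open>F\<close>, then the maximum of all \<open>f i - c i\<close> and
  all \<open>g j\<close> is nonnegative on the whole of \<open>\<Omega>\<close>. If almost minimisers existed arbitrarily far out, a
  multiplier rule for maxima, applied near each of them, would produce in the limit weights from the
  unit simplex, elements of the subdifferentials at infinity and a normal at infinity that cancel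
  (\<open>multipliers_at_infinity\<close>). If the weights of the \<open>f i\<close> all vanish this contradicts the constraint
  qualification; otherwise, divided by their total, it contradicts the separation hypothesis.

  Because a limit is taken at the end, the multiplier rule is needed only approximately, and
  smoothing proves it without subdifferential calculus (\<open>approximate_multiplier_rule\<close>). Each function
  gets a variable of its own, the maximum is replaced by the logarithm of a sum of exponentials, and
  quadratic terms tie the variables to a point of \<open>\<Omega>\<close> and that point to the almost minimiser. On a
  compact neighbourhood, where all functions are Lipschitz, a minimiser exists and is interior; the
  minimum in each variable separately is a proximal subgradient inequality or a proximal normal
  inequality, and the gradients of the quadratic terms cancel up to a small error.
\<close>

section \<open>Normal cones and proximal subgradients\<close>

lemma frechet_normal_cone_iff:
  "v \<in> frechet_normal_cone D x \<longleftrightarrow>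
    (\<forall>\<epsilon>>0. \<forall>\<^sub>F y in at x within D. inner v (y - x) \<le> \<epsilon> * norm (y - x))"
    (is "_ \<longleftrightarrow> ?R")
proof -
  let ?q = "\<lambda>y. inner v (y - x) / norm (y - x)"
  have "v \<in> frechet_normal_cone D x \<longleftrightarrow>
      (\<forall>z>0. \<forall>\<^sub>F y in at x within D. ereal (?q y) < z)"
    unfolding frechet_normal_cone_def by (simp add: Limsup_le_iff)
  also have "\<dots> \<longleftrightarrow> ?R"
  proof (intro iffI allI impI)
    fix \<epsilon> :: real
    assume *: "\<forall>z>0. \<forall>\<^sub>F y in at x within D. ereal (?q y) < z" and "\<epsilon> > 0"
    then have "\<forall>\<^sub>F y in at x within D. ereal (?q y) < ereal \<epsilon>"
      using *[rule_format, of "ereal \<epsilon>"] by simp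
    moreover have "\<forall>\<^sub>F y in at x within D. y \<noteq> x"
      by (simp add: eventually_at_filter)
    ultimately show "\<forall>\<^sub>F y in at x within D. inner v (y - x) \<le> \<epsilon> * norm (y - x)"
      by eventually_elim (simp add: divide_simps mult.commute split: if_splits)
  next
    fix z :: ereal
    assume *: ?R and "z > 0"
    then obtain \<epsilon> where \<epsilon>: "\<epsilon> > 0" "ereal \<epsilon> < z"
      using ereal_dense2[of 0 z] by auto
    have "\<forall>\<^sub>F y in at x within D. inner v (y - x) \<le> \<epsilon> * norm (y - x)"
      using * \<epsilon>(1) by blast
    then show "\<forall>\<^sub>F y in at x within D. ereal (?q y) < z"
    proof eventually_elim
      case (elim y)
      then have "?q y \<le> \<epsilon>"
        using \<epsilon>(1) by (cases "y = x") (simp_all add: divide_simps mult.commute)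
      then show ?case using \<epsilon>(2) le_less_trans[of "ereal (?q y)" "ereal \<epsilon>" z] by simp
    qed
  qed
  finally show ?thesis .
qed

lemma frechet_normal_cone_scaleR:
  assumes "v \<in> frechet_normal_cone D x" "c > 0"
  shows "c *\<^sub>R v \<in> frechet_normal_cone D x"
  unfolding frechet_normal_cone_iff
proof (intro allI impI)
  fix \<epsilon> :: real assume "\<epsilon> > 0"
  then have "\<forall>\<^sub>F y in at x within D. inner v (y - x) \<le> (\<epsilon> / c) * norm (y - x)"
    using assms divide_pos_pos[of \<epsilon> c] unfolding frechet_normal_cone_iff by blast
  then show "\<forall>\<^sub>F y in at x within D. inner (c *\<^sub>R v) (y - x) \<le> \<epsilon> * norm (y - x)"
    by eventually_elim (use assms(2) in \<open>simp add: field_simps\<close>)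
qed

lemma normal_cone_at_infinity_scaleR:
  assumes "v \<in> normal_cone_at_infinity D" "c > 0"
  shows "c *\<^sub>R v \<in> normal_cone_at_infinity D"
proof -
  obtain xs vs where *: "\<And>k. xs k \<in> D" "filterlim (\<lambda>k. norm (xs k)) at_top sequentially"
      "\<And>k. vs k \<in> frechet_normal_cone D (xs k)" "vs \<longlonglongrightarrow> v"
    using assms(1) unfolding normal_cone_at_infinity_def by blast
  have "(\<lambda>k. c *\<^sub>R vs k) \<longlonglongrightarrow> c *\<^sub>R v"
    by (intro tendsto_intros *)
  moreover have "\<And>k. c *\<^sub>R vs k \<in> frechet_normal_cone D (xs k)"
    using *(3) assms(2) by (rule frechet_normal_cone_scaleR)
  ultimately show ?thesis
    unfolding normal_cone_at_infinity_def using *(1,2)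
    by (intro CollectI exI[of _ xs] exI[of _ "\<lambda>k. c *\<^sub>R vs k"]) auto
qed

text \<open>
  The quotient in the definition is at most \<open>K * norm (y - x)\<close>, which tends to zero: proximal
  normals are Frechet normals. All normals below arise from minimisers of functions with quadratic
  terms, so they come in this form.
\<close>

lemma frechet_normal_cone_quadraticI:
  assumes "r > 0"
    and "\<And>y. y \<in> D \<Longrightarrow> norm (y - x) < r \<Longrightarrow> inner v (y - x) \<le> K * (norm (y - x))\<^sup>2"
  shows "v \<in> frechet_normal_cone D x"
  unfolding frechet_normal_cone_iff
proof (intro allI impI)
  fix \<epsilon> :: real assume "\<epsilon> > 0"
  show "\<forall>\<^sub>F y in at x within D. inner v (y - x) \<le> \<epsilon> * norm (y - x)"
    unfolding eventually_at
  proof (intro exI[of _ "min r (\<epsilon> / (\<bar>K\<bar> + 1))"] conjI ballI impI)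
    show "0 < min r (\<epsilon> / (\<bar>K\<bar> + 1))" using assms(1) \<open>\<epsilon> > 0\<close> by simp
  next
    fix y assume y: "y \<in> D" "y \<noteq> x \<and> dist y x < min r (\<epsilon> / (\<bar>K\<bar> + 1))"
    then have n: "norm (y - x) < r" "norm (y - x) * (\<bar>K\<bar> + 1) < \<epsilon>"
      by (simp_all add: dist_norm field_simps add_pos_nonneg)
    have "K * norm (y - x) \<le> (\<bar>K\<bar> + 1) * norm (y - x)"
      by (intro mult_right_mono) auto
    then have "K * norm (y - x) \<le> \<epsilon>" using n(2) by (simp add: mult.commute)
    then have "K * norm (y - x) * norm (y - x) \<le> \<epsilon> * norm (y - x)"
      by (intro mult_right_mono) auto
    then show "inner v (y - x) \<le> \<epsilon> * norm (y - x)"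
      using assms(2)[OF y(1) n(1)] by (simp add: power2_eq_square)
  qed
qed

lemma frechet_imp_limiting_normal:
  assumes "x \<in> D" "v \<in> frechet_normal_cone D x"
  shows "v \<in> limiting_normal_cone D x"
  unfolding limiting_normal_cone_def using assms
  by (intro CollectI exI[of _ "\<lambda>_. x"] exI[of _ "\<lambda>_. v"]) auto

text \<open>
  The quadratic minorant makes this notion stronger than that of a Frechet subgradient; it is what
  minimality of a function with an added quadratic yields directly.
\<close>

definition proximal_subgradient :: "('a::real_inner \<Rightarrow> real) \<Rightarrow> 'a \<Rightarrow> 'a \<Rightarrow> bool"
  where "proximal_subgradient h x u \<longleftrightarrow>
    (\<exists>K. \<exists>r>0. \<forall>y. norm (y - x) < r \<longrightarrow> h x + inner u (y - x) - K * (norm (y - x))\<^sup>2 \<le> h y)"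

text \<open>
  The epigraph lies above the graph, and a point \<open>(y, t)\<close> of it is at least as far from
  \<open>(x, h x)\<close> as \<open>y\<close> is from \<open>x\<close>. Hence the minorant of \<open>h\<close> at \<open>y\<close> is a quadratic normal inequality at
  \<open>(y, t)\<close>.
\<close>

lemma proximal_subgradient_imp_epigraph_normal:
  assumes "proximal_subgradient h x u"
  shows "(u, -1) \<in> limiting_normal_cone (epigraph UNIV h) (x, h x)"
proof (rule frechet_imp_limiting_normal)
  show "(x, h x) \<in> epigraph UNIV h" by (simp add: epigraph_def)
  obtain K r where r: "r > 0"
    and K: "\<And>y. norm (y - x) < r \<Longrightarrow> h x + inner u (y - x) - K * (norm (y - x))\<^sup>2 \<le> h y"
    using assms unfolding proximal_subgradient_def by blast
  show "(u, -1) \<in> frechet_normal_cone (epigraph UNIV h) (x, h x)"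
  proof (rule frechet_normal_cone_quadraticI[OF r, where K = "\<bar>K\<bar>"])
    fix z assume z: "z \<in> epigraph UNIV h" "norm (z - (x, h x)) < r"
    obtain y t where zz: "z = (y, t)" by fastforce
    have ht: "h y \<le> t" using z(1) by (simp add: zz epigraph_def)
    have n: "norm (y - x) \<le> norm (z - (x, h x))"
      unfolding zz using norm_fst_le[of "y - x" "t - h x"] by simp
    have "inner (u, -1) (z - (x, h x)) = inner u (y - x) - (t - h x)"
      by (simp add: zz inner_prod_def)
    also have "\<dots> \<le> K * (norm (y - x))\<^sup>2"
      using K[of y] n z(2) ht by simp
    also have "\<dots> \<le> \<bar>K\<bar> * (norm (z - (x, h x)))\<^sup>2"
      using n by (intro mult_mono power_mono) auto
    finally show "inner (u, -1) (z - (x, h x)) \<le> \<bar>K\<bar> * (norm (z - (x, h x)))\<^sup>2" .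
  qed
qed

text \<open>
  Moving from \<open>x\<close> a distance \<open>t * norm u\<close> in the direction of \<open>u\<close>, the minorant rises at rate
  \<open>norm u\<close> up to an error of order \<open>t\<close>, while \<open>h\<close> rises at rate at most \<open>L\<close>; then \<open>t\<close> tends to zero.
\<close>

lemma proximal_subgradient_norm_le:
  assumes "proximal_subgradient h x u" "\<rho> > 0" "0 \<le> L"
    and lip: "\<And>y. norm (y - x) < \<rho> \<Longrightarrow> h y - h x \<le> L * norm (y - x)"
  shows "norm u \<le> L"
proof (cases "u = 0")
  case True
  then show ?thesis using assms(3) by simp
next
  case False
  obtain K r where r: "r > 0"
    and K: "\<And>y. norm (y - x) < r \<Longrightarrow> h x + inner u (y - x) - K * (norm (y - x))\<^sup>2 \<le> h y"
    using assms unfolding proximal_subgradient_def by blast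
  define s where "s = min r \<rho> / norm u"
  have s: "s > 0" using r assms(2) False by (simp add: s_def)
  have "\<forall>\<^sub>F t in at_right 0. norm u \<le> L + K * (t * norm u)"
    unfolding eventually_at_right_field
  proof (intro exI[of _ s] conjI s allI impI)
    fix t :: real assume t: "t > 0" "t < s"
    define y where "y = x + t *\<^sub>R u"
    have yn: "norm (y - x) = t * norm u" using t by (simp add: y_def)
    also have "\<dots> < min r \<rho>" using t False by (simp add: s_def field_simps)
    finally have "inner u (y - x) \<le> L * norm (y - x) + K * (norm (y - x))\<^sup>2"
      using K[of y] lip[of y] by simp
    moreover have "inner u (y - x) = norm u * (t * norm u)"
      by (simp add: y_def power2_norm_eq_inner[symmetric] power2_eq_square)
    ultimately have "norm u * (t * norm u) \<le> (L + K * (t * norm u)) * (t * norm u)"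
      by (simp add: yn power2_eq_square algebra_simps)
    then show "norm u \<le> L + K * (t * norm u)"
      using t False by simp
  qed
  moreover have "((\<lambda>t. L + K * (t * norm u)) \<longlongrightarrow> L + K * (0 * norm u)) (at_right 0)"
    by (intro tendsto_intros)
  ultimately show ?thesis
    using tendsto_lowerbound[of "\<lambda>t. L + K * (t * norm u)" _ "at_right 0" "norm u"] by simp
qed

section \<open>A smooth approximation of the maximum\<close>

text \<open>
  As \<open>T\<close> tends to zero this tends to the maximum of the \<open>t a\<close>; \<open>softmax\<close> is its gradient.
\<close>

definition log_sum_exp :: "real \<Rightarrow> 'b set \<Rightarrow> ('b \<Rightarrow> real) \<Rightarrow> real"
  where "log_sum_exp T A t = T * ln (\<Sum>a\<in>A. exp (t a / T))"

definition softmax :: "real \<Rightarrow> 'b set \<Rightarrow> ('b \<Rightarrow> real) \<Rightarrow> 'b \<Rightarrow> real"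
  where "softmax T A t a = exp (t a / T) / (\<Sum>b\<in>A. exp (t b / T))"

lemma sum_exp_pos:
  assumes "finite A" "A \<noteq> {}"
  shows "0 < (\<Sum>a\<in>A. exp (t a / T :: real))"
  using assms by (intro sum_pos) auto

lemma log_sum_exp_ge:
  assumes "finite A" "a \<in> A" "T > 0"
  shows "t a \<le> log_sum_exp T A t"
proof -
  have "exp (t a / T) \<le> (\<Sum>a\<in>A. exp (t a / T))"
    using assms by (intro member_le_sum) auto
  then have "ln (exp (t a / T)) \<le> ln (\<Sum>a\<in>A. exp (t a / T))"
    by (intro ln_mono) auto
  then show ?thesis using assms(3) by (simp add: log_sum_exp_def field_simps)
qed

lemma log_sum_exp_le:
  assumes "finite A" "A \<noteq> {}" "T > 0" "\<And>a. a \<in> A \<Longrightarrow> t a \<le> m"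
  shows "log_sum_exp T A t \<le> m + T * card A"
proof -
  have "(\<Sum>a\<in>A. exp (t a / T)) \<le> (\<Sum>a\<in>A. exp (m / T))"
    using assms by (intro sum_mono) (simp add: divide_right_mono)
  also have "\<dots> = real (card A) * exp (m / T)" by simp
  finally have "ln (\<Sum>a\<in>A. exp (t a / T)) \<le> ln (real (card A) * exp (m / T))"
    using sum_exp_pos[OF assms(1,2)] by (intro ln_mono) auto
  also have "\<dots> = ln (card A) + m / T"
    using assms(1,2) by (simp add: ln_mult card_gt_0_iff)
  also have "\<dots> \<le> card A + m / T"
    using assms(1,2) ln_le_minus_one[of "real (card A)"] by (simp add: card_gt_0_iff)
  finally have "T * ln (\<Sum>a\<in>A. exp (t a / T)) \<le> T * (card A + m / T)"
    using assms(3) by (intro mult_left_mono) auto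
  then show ?thesis using assms(3) by (simp add: log_sum_exp_def algebra_simps)
qed

lemma softmax_pos: "finite A \<Longrightarrow> A \<noteq> {} \<Longrightarrow> 0 < softmax T A t a"
  unfolding softmax_def using sum_exp_pos by (intro divide_pos_pos) auto

lemma sum_softmax: "finite A \<Longrightarrow> A \<noteq> {} \<Longrightarrow> (\<Sum>a\<in>A. softmax T A t a) = 1"
  using sum_exp_pos[of A t T] by (simp add: softmax_def sum_divide_distrib[symmetric])

lemma exp_le_quadratic:
  fixes x :: real
  assumes "\<bar>x\<bar> \<le> 1"
  shows "exp x \<le> 1 + x + x\<^sup>2"
proof (cases "0 \<le> x")
  case True
  then show ?thesis using assms exp_bound by simp
next
  case False
  define y where "y = - x"
  have y: "0 < y" "y \<le> 1" using False assms by (auto simp: y_def)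
  have "1 + y \<le> exp y" by (rule exp_ge_add_one_self)
  then have "exp x \<le> 1 / (1 + y)"
    using y by (simp add: y_def exp_minus field_simps)
  also have "\<dots> \<le> 1 - y + y\<^sup>2"
  proof -
    have "(1 - y + y\<^sup>2) * (1 + y) = 1 + y ^ 3"
      by (simp add: algebra_simps power2_eq_square power3_eq_cube)
    also have "\<dots> \<ge> 1" using y by simp
    finally show ?thesis using y by (simp add: divide_simps)
  qed
  finally show ?thesis by (simp add: y_def)
qed

text \<open>
  The change of one entry multiplies the sum of exponentials by \<open>1 + \<theta>\<close> with
  \<open>\<theta> = softmax T A t a * (exp (\<tau> / T) - 1)\<close>, and \<open>ln (1 + \<theta>) \<le> \<theta>\<close>. This is a first-order expansion with
  quadratic error, the upper estimate by which minimality of a log-sum-exp of functions passes to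
  each single function.
\<close>

lemma log_sum_exp_update_le:
  assumes "finite A" "a \<in> A" "T > 0" "\<bar>\<tau>\<bar> \<le> T"
  shows "log_sum_exp T A (t(a := t a + \<tau>)) \<le> log_sum_exp T A t + softmax T A t a * (\<tau> + \<tau>\<^sup>2 / T)"
proof -
  define S where "S = (\<Sum>b\<in>A. exp (t b / T))"
  have S: "S > 0" using assms sum_exp_pos[of A] by (auto simp: S_def)
  define \<theta> where "\<theta> = softmax T A t a * (exp (\<tau> / T) - 1)"
  have "(\<Sum>b\<in>A. exp ((t(a := t a + \<tau>)) b / T)) =
      exp ((t a + \<tau>) / T) + (\<Sum>b\<in>A - {a}. exp (t b / T))"
    using assms(1,2) by (subst sum.remove[of _ a]) auto
  also have "(\<Sum>b\<in>A - {a}. exp (t b / T)) = S - exp (t a / T)"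
    using assms(1,2) by (simp add: S_def sum_diff1)
  also have "exp ((t a + \<tau>) / T) + (S - exp (t a / T)) = S * (1 + \<theta>)"
    using S by (simp add: \<theta>_def softmax_def S_def[symmetric] add_divide_distrib exp_add field_simps)
  finally have eq: "(\<Sum>b\<in>A. exp ((t(a := t a + \<tau>)) b / T)) = S * (1 + \<theta>)" .
  have "0 < S * (1 + \<theta>)" unfolding eq[symmetric] using assms(1,2) by (intro sum_exp_pos) auto
  then have \<theta>1: "1 + \<theta> > 0" using S by (simp add: zero_less_mult_iff)
  have "ln (S * (1 + \<theta>)) = ln S + ln (1 + \<theta>)"
    using S \<theta>1 by (simp add: ln_mult)
  also have "\<dots> \<le> ln S + \<theta>" using \<theta>1 ln_le_minus_one[of "1 + \<theta>"] by simp
  also have "\<theta> \<le> softmax T A t a * (\<tau> / T + (\<tau> / T)\<^sup>2)"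
    unfolding \<theta>_def using assms exp_le_quadratic[of "\<tau> / T"]
    by (intro mult_left_mono less_imp_le[OF softmax_pos]) (auto simp: abs_divide)
  finally have "T * ln (S * (1 + \<theta>)) \<le> T * (ln S + softmax T A t a * (\<tau> / T + (\<tau> / T)\<^sup>2))"
    using assms(3) by simp
  also have "\<dots> = T * ln S + softmax T A t a * (\<tau> + \<tau>\<^sup>2 / T)"
    using assms(3) by (simp add: field_simps power2_eq_square)
  finally show ?thesis unfolding log_sum_exp_def eq S_def[symmetric] .
qed

lemma continuous_on_log_sum_exp:
  assumes "finite A" "A \<noteq> {}" "\<And>a. a \<in> A \<Longrightarrow> continuous_on S (\<lambda>p. t p a)"
  shows "continuous_on S (\<lambda>p. log_sum_exp T A (t p))"
proof -
  have "continuous_on S (\<lambda>p. t p a / T)" if "a \<in> A" for a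
    using continuous_on_mult_right[OF assms(3)[OF that], of "inverse T"] by (simp add: divide_inverse)
  moreover have "(\<Sum>a\<in>A. exp (t p a / T)) \<noteq> 0" for p
    using sum_exp_pos[OF assms(1,2), of "t p" T] by simp
  ultimately show ?thesis
    unfolding log_sum_exp_def
    by (intro continuous_on_mult continuous_on_const continuous_on_ln continuous_on_sum
        continuous_on_exp) auto
qed

section \<open>The approximate multiplier rule\<close>

lemma compact_PiE_UNIV:
  fixes S :: "'b \<Rightarrow> 'a::topological_space set"
  assumes "\<And>i. compact (S i)"
  shows "compact (PiE UNIV S)"
  using assms compactin_PiE[of "\<lambda>_. euclidean" UNIV S]
  by (simp add: euclidean_product_topology)

text \<open>
  A maximum of functions that is nonnegative on \<open>\<Omega>\<close> and at most \<open>e / 4\<close> at \<open>x0\<close> is almost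
  stationary near \<open>x0\<close>. The function
  \<open>log_sum_exp T A (\<lambda>a. h a (x a)) + M / 2 * (\<Sum>a\<in>A. (norm (x a - w))\<^sup>2) + e / 2 * (norm (w - x0))\<^sup>2\<close>
  is minimised over points \<open>x a\<close> near \<open>x0\<close> and \<open>w \<in> \<Omega>\<close> near \<open>x0\<close>. Small \<open>T\<close> makes the smoothing
  accurate, and large \<open>M\<close> makes the decoupling harmless; comparison with the value at \<open>x0\<close> then shows
  that the minimiser is interior. Its optimality in \<open>x a\<close> gives
  \<open>u a = - (M / c a) *\<^sub>R (x a - w)\<close> as a subgradient, \<open>c\<close> being the softmax weights, and its optimality in
  \<open>w\<close> gives the normal \<open>v\<close>. The terms with \<open>M\<close> cancel in \<open>(\<Sum>a\<in>A. c a *\<^sub>R u a) + v\<close>, and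
  \<open>- e *\<^sub>R (w - x0)\<close> remains.
\<close>

lemma approximate_multiplier_rule:
  fixes h :: "'b \<Rightarrow> 'a::euclidean_space \<Rightarrow> real"
  assumes "finite A" and "closed \<Omega>" and x0: "x0 \<in> \<Omega>" and e: "0 < e" "e \<le> 1" and "L > 0"
    and lip: "\<And>a x y. a \<in> A \<Longrightarrow> x \<in> cball x0 2 \<Longrightarrow> y \<in> cball x0 2 \<Longrightarrow>
      \<bar>h a x - h a y\<bar> \<le> L * norm (x - y)"
    and small: "\<And>a. a \<in> A \<Longrightarrow> h a x0 \<le> e / 4"
    and nonneg: "\<And>w. w \<in> \<Omega> \<Longrightarrow> \<exists>a\<in>A. 0 \<le> h a w"
  shows "\<exists>c x u w v. (\<forall>a\<in>A. 0 \<le> c a) \<and> sum c A = 1 \<and>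
      (\<forall>a\<in>A. x a \<in> cball x0 2 \<and> proximal_subgradient (h a) (x a) (u a) \<and> norm (u a) \<le> L) \<and>
      w \<in> \<Omega> \<and> w \<in> cball x0 2 \<and> v \<in> frechet_normal_cone \<Omega> w \<and>
      norm ((\<Sum>a\<in>A. c a *\<^sub>R u a) + v) \<le> e"
proof -
  have ne: "A \<noteq> {}" using nonneg[OF x0] by auto
  define N where "N = real (card A)"
  have N: "N \<ge> 1" using \<open>finite A\<close> ne by (simp add: N_def Suc_le_eq card_gt_0_iff)
  \<comment> \<open>The smoothing error is at most \<open>T * N\<close> and the decoupling error at most \<open>L\<^sup>2 / M\<close>; neither
    exceeds \<open>e / 16\<close>, so that with the \<open>e / 4\<close> from \<open>x0\<close> they stay below the value \<open>e / 2\<close> that the last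
    term takes at \<open>norm (w - x0) = 1\<close>.\<close>
  define T where "T = e / (16 * N)"
  have T: "T > 0" "T * N = e / 16" using e N by (simp_all add: T_def)
  \<comment> \<open>The summand 4 gives \<open>q \<le> M / 4 * q\<close> below, so that the energy bound forces \<open>q < 1\<close>.\<close>
  define M where "M = 4 + 16 * L\<^sup>2 / e"
  have "L\<^sup>2 / e \<ge> 0" using e by simp
  then have M: "M \<ge> 4" by (simp add: M_def)
  have LM: "L\<^sup>2 / M \<le> e / 16"
  proof -
    have "L\<^sup>2 = (16 * L\<^sup>2 / e) * (e / 16)" using e by simp
    also have "\<dots> \<le> M * (e / 16)" using e by (intro mult_right_mono) (auto simp: M_def)
    finally show ?thesis using M by (simp add: field_simps)
  qed
  define G where "G = (\<lambda>p :: ('b \<Rightarrow> 'a) \<times> 'a. log_sum_exp T A (\<lambda>a. h a (fst p a))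
      + M / 2 * (\<Sum>a\<in>A. (norm (fst p a - snd p))\<^sup>2) + e / 2 * (norm (snd p - x0))\<^sup>2)"
  define D where "D = (PiE UNIV (\<lambda>_::'b. cball x0 2)) \<times> (\<Omega> \<inter> cball x0 1)"
  have "compact D"
    unfolding D_def using \<open>closed \<Omega>\<close>
    by (intro compact_Times compact_PiE_UNIV closed_Int_compact) auto
  moreover have "((\<lambda>_. x0), x0) \<in> D" using x0 by (auto simp: D_def)
  moreover have "continuous_on D G"
  proof -
    have coord: "continuous_on D (\<lambda>p. fst p a)" for a
      by (rule continuous_on_compose2[OF continuous_on_product_coordinates[of a]])
         (auto intro: continuous_intros)
    have "continuous_on (cball x0 2) (h a)" if "a \<in> A" for a
    proof (rule lipschitz_on_continuous_on)
      show "L-lipschitz_on (cball x0 2) (h a)"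
        using lip[OF that] \<open>L > 0\<close> by (intro lipschitz_onI) (auto simp: dist_norm)
    qed
    then have "continuous_on D (\<lambda>p. h a (fst p a))" if "a \<in> A" for a
      using that by (intro continuous_on_compose2[OF _ coord]) (auto simp: D_def)
    then show ?thesis
      unfolding G_def
      by (intro continuous_intros continuous_on_log_sum_exp coord \<open>finite A\<close> ne)
  qed
  ultimately obtain p where p: "p \<in> D" "\<And>q. q \<in> D \<Longrightarrow> G p \<le> G q"
    using continuous_attains_inf[of D G] by blast
  obtain x w where xw: "p = (x, w)" by fastforce
  have x2: "x a \<in> cball x0 2" for a using p(1) by (auto simp: D_def xw)
  have w: "w \<in> \<Omega>" "w \<in> cball x0 1" using p(1) by (auto simp: D_def xw)
  define q where "q = (\<Sum>a\<in>A. (norm (x a - w))\<^sup>2)"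
  have x_le_q: "(norm (x a - w))\<^sup>2 \<le> q" if "a \<in> A" for a
    unfolding q_def using \<open>finite A\<close> that by (intro member_le_sum) auto
  \<comment> \<open>The minimal value is at most the value with all variables at \<open>x0\<close>. It is bounded below
    through an index \<open>b\<close> with \<open>h b w \<ge> 0\<close>: passing from \<open>w\<close> to \<open>x b\<close> costs at most
    \<open>L * norm (x b - w)\<close>, which half of the coupling term absorbs up to \<open>L\<^sup>2 / M\<close>. Hence all variables
    are strictly inside their balls.\<close>
  have "G p \<le> G ((\<lambda>_. x0), x0)"
    by (rule p(2)) (use x0 in \<open>auto simp: D_def\<close>)
  also have "\<dots> \<le> e / 4 + T * N"
    unfolding G_def N_def using log_sum_exp_le[OF \<open>finite A\<close> ne T(1), of "\<lambda>a. h a x0"] small by simp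
  finally have upper: "G p \<le> 5 * e / 16" using T(2) by simp
  obtain b where b: "b \<in> A" "0 \<le> h b w" using nonneg[OF w(1)] by blast
  have "- L\<^sup>2 / M - M / 4 * q \<le> - (L * norm (x b - w))"
  proof -
    have "0 \<le> (L / M - norm (x b - w) / 2)\<^sup>2 * M" using M by simp
    also have "\<dots> = L\<^sup>2 / M + M / 4 * (norm (x b - w))\<^sup>2 - L * norm (x b - w)"
      using M by (simp add: power2_diff field_simps power2_eq_square)
    also have "\<dots> \<le> L\<^sup>2 / M + M / 4 * q - L * norm (x b - w)"
      using x_le_q[OF b(1)] M by simp
    finally show ?thesis by simp
  qed
  also have "\<dots> \<le> h b (x b)"
    using lip[OF b(1) x2[of b], of w] w(2) b(2) by simp
  also have "\<dots> \<le> log_sum_exp T A (\<lambda>a. h a (x a))"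
    using log_sum_exp_ge[OF \<open>finite A\<close> b(1) T(1), of "\<lambda>a. h a (x a)"] .
  finally have "- L\<^sup>2 / M + M / 4 * q + e / 2 * (norm (w - x0))\<^sup>2 \<le> G p"
    by (simp add: G_def xw q_def)
  then have energy: "M / 4 * q + e / 2 * (norm (w - x0))\<^sup>2 \<le> 3 * e / 8"
    using upper LM by simp
  have q0: "q \<ge> 0" unfolding q_def by (intro sum_nonneg) auto
  have "e / 2 * (norm (w - x0))\<^sup>2 \<le> 3 * e / 8"
    using energy q0 M mult_nonneg_nonneg[of "M / 4" q] by linarith
  then have "(norm (w - x0))\<^sup>2 < 1\<^sup>2" using e by simp
  then have w1: "norm (w - x0) < 1" by (rule power2_less_imp_less) simp
  have "q \<le> M / 4 * q" using M q0 mult_right_mono[of 1 "M / 4" q] by simp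
  also have "\<dots> \<le> M / 4 * q + e / 2 * (norm (w - x0))\<^sup>2" using e by simp
  also note energy
  finally have "q < 1" using e by simp
  have xw1: "norm (x a - w) < 1" if "a \<in> A" for a
  proof (rule power2_less_imp_less)
    show "(norm (x a - w))\<^sup>2 < 1\<^sup>2" using x_le_q[OF that] \<open>q < 1\<close> by simp
  qed simp
  have x2': "norm (x a - x0) < 2" if "a \<in> A" for a
    using norm_triangle_ineq[of "x a - w" "w - x0"] xw1[OF that] w1 by simp
  define c where "c = softmax T A (\<lambda>a. h a (x a))"
  have c: "c a > 0" for a unfolding c_def using softmax_pos[OF \<open>finite A\<close> ne] .
  have c1: "sum c A = 1" unfolding c_def using sum_softmax[OF \<open>finite A\<close> ne] .
  define u where "u = (\<lambda>a. - (M / c a) *\<^sub>R (x a - w))"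
  have prox: "proximal_subgradient (h a) (x a) (u a)" if a: "a \<in> A" for a
    unfolding proximal_subgradient_def
  proof (intro exI conjI allI impI)
    \<comment> \<open>Within this radius \<open>y\<close> remains an admissible value of the variable with index \<open>a\<close>, and \<open>h a\<close>
      changes by at most \<open>T\<close>, as the expansion of the log-sum-exp requires.\<close>
    let ?r = "min (2 - norm (x a - x0)) (T / L)"
    show "?r > 0" using x2'[OF a] T(1) \<open>L > 0\<close> by simp
    fix y assume y: "norm (y - x a) < ?r"
    have y2: "y \<in> cball x0 2"
      using norm_triangle_ineq[of "y - x a" "x a - x0"] y by (simp add: dist_norm norm_minus_commute)
    define \<tau> where "\<tau> = h a y - h a (x a)"
    have \<tau>: "\<bar>\<tau>\<bar> \<le> L * norm (y - x a)"
      unfolding \<tau>_def using lip[OF a y2 x2] .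
    also have "\<dots> \<le> T" using y \<open>L > 0\<close> by (simp add: field_simps)
    finally have \<tau>T: "\<bar>\<tau>\<bar> \<le> T" .
    have "\<tau>\<^sup>2 \<le> (L * norm (y - x a))\<^sup>2"
      using \<tau> by (rule abs_le_square_iff[THEN iffD1, OF order_trans]) simp
    then have \<tau>2: "c a * (\<tau>\<^sup>2 / T) \<le> c a * (L\<^sup>2 * (norm (y - x a))\<^sup>2 / T)"
      using T(1) c[of a] by (simp add: power_mult_distrib divide_right_mono)
    have "(x(a := y), w) \<in> D" using p(1) y2 by (auto simp: D_def xw)
    then have G_le: "G p \<le> G (x(a := y), w)" by (rule p(2))
    have "(norm (y - w))\<^sup>2 = (norm (x a - w))\<^sup>2 + 2 * inner (x a - w) (y - x a) + (norm (y - x a))\<^sup>2"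
      by (simp add: power2_norm_eq_inner algebra_simps inner_commute)
    moreover have "(\<Sum>b\<in>A - {a}. (norm ((x(a := y)) b - w))\<^sup>2) = (\<Sum>b\<in>A - {a}. (norm (x b - w))\<^sup>2)"
      by (intro sum.cong) auto
    ultimately have q': "(\<Sum>b\<in>A. (norm ((x(a := y)) b - w))\<^sup>2) =
        q + (2 * inner (x a - w) (y - x a) + (norm (y - x a))\<^sup>2)"
      unfolding q_def using \<open>finite A\<close> a by (simp add: sum.remove[of A a])
    have h': "(\<lambda>b. h b ((x(a := y)) b)) = (\<lambda>b. h b (x b))(a := h a (x a) + \<tau>)"
      by (auto simp: \<tau>_def)
    have "log_sum_exp T A (\<lambda>b. h b (x b)) \<le>
        log_sum_exp T A ((\<lambda>b. h b (x b))(a := h a (x a) + \<tau>))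
        + M / 2 * (2 * inner (x a - w) (y - x a) + (norm (y - x a))\<^sup>2)"
      using G_le unfolding G_def xw fst_conv snd_conv q_def[symmetric] q' h'
        distrib_left[of "M / 2" q] by linarith
    also have "\<dots> \<le> log_sum_exp T A (\<lambda>b. h b (x b)) + c a * (\<tau> + \<tau>\<^sup>2 / T)
        + M / 2 * (2 * inner (x a - w) (y - x a) + (norm (y - x a))\<^sup>2)"
      using log_sum_exp_update_le[OF \<open>finite A\<close> a T(1) \<tau>T, of "\<lambda>b. h b (x b)"]
      by (simp add: c_def)
    finally have "0 \<le> c a * \<tau> + c a * (L\<^sup>2 * (norm (y - x a))\<^sup>2 / T)
        + M * inner (x a - w) (y - x a) + M / 2 * (norm (y - x a))\<^sup>2"
      using \<tau>2 by (simp add: algebra_simps)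
    also have "\<dots> = c a * (\<tau> - inner (u a) (y - x a)
        + (L\<^sup>2 / T + M / (2 * c a)) * (norm (y - x a))\<^sup>2)"
    proof -
      have "c a * inner (u a) (y - x a) = - M * inner (x a - w) (y - x a)"
        using c[of a] by (simp add: u_def)
      then show ?thesis using c[of a] by (simp add: algebra_simps)
    qed
    finally have "0 \<le> \<tau> - inner (u a) (y - x a) + (L\<^sup>2 / T + M / (2 * c a)) * (norm (y - x a))\<^sup>2"
      using c[of a] by (simp add: zero_le_mult_iff)
    then show "h a (x a) + inner (u a) (y - x a)
        - (L\<^sup>2 / T + M / (2 * c a)) * (norm (y - x a))\<^sup>2 \<le> h a y"
      by (simp add: \<tau>_def)
  qed
  have ubound: "norm (u a) \<le> L" if a: "a \<in> A" for a
  proof (rule proximal_subgradient_norm_le[OF prox[OF a]])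
    show "0 < 2 - norm (x a - x0)" using x2'[OF a] by simp
    show "0 \<le> L" using \<open>L > 0\<close> by simp
    fix y assume "norm (y - x a) < 2 - norm (x a - x0)"
    then have "y \<in> cball x0 2"
      using norm_triangle_ineq[of "y - x a" "x a - x0"] by (simp add: dist_norm norm_minus_commute)
    then show "h a y - h a (x a) \<le> L * norm (y - x a)"
      using lip[OF a _ x2[of a], of y] by simp
  qed
  define v where "v = M *\<^sub>R (\<Sum>a\<in>A. x a - w) - e *\<^sub>R (w - x0)"
  have "v \<in> frechet_normal_cone \<Omega> w"
  proof (rule frechet_normal_cone_quadraticI)
    show "0 < 1 - norm (w - x0)" using w1 by simp
    fix y assume y: "y \<in> \<Omega>" "norm (y - w) < 1 - norm (w - x0)"
    have "y \<in> cball x0 1"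
      using norm_triangle_ineq[of "y - w" "w - x0"] y(2) by (simp add: dist_norm norm_minus_commute)
    then have "(x, y) \<in> D" using p(1) y(1) by (auto simp: D_def xw)
    then have G_le: "G p \<le> G (x, y)" by (rule p(2))
    have "(norm (x a - y))\<^sup>2 = (norm (x a - w))\<^sup>2 - 2 * inner (x a - w) (y - w) + (norm (y - w))\<^sup>2" for a
      by (simp add: power2_norm_eq_inner algebra_simps inner_commute)
    then have q': "(\<Sum>a\<in>A. (norm (x a - y))\<^sup>2) =
        q + (N * (norm (y - w))\<^sup>2 - 2 * inner (\<Sum>a\<in>A. x a - w) (y - w))"
      by (simp add: sum.distrib sum_subtractf[of "\<lambda>a. (norm (x a - w))\<^sup>2"] sum_distrib_left
          inner_sum_left q_def N_def)
    have d': "(norm (y - x0))\<^sup>2 =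
        (norm (w - x0))\<^sup>2 + (2 * inner (w - x0) (y - w) + (norm (y - w))\<^sup>2)"
      by (simp add: power2_norm_eq_inner algebra_simps inner_commute)
    have "0 \<le> M / 2 * (N * (norm (y - w))\<^sup>2 - 2 * inner (\<Sum>a\<in>A. x a - w) (y - w))
       + e / 2 * (2 * inner (w - x0) (y - w) + (norm (y - w))\<^sup>2)"
      using G_le unfolding G_def xw fst_conv snd_conv q_def[symmetric] q' d'
        distrib_left[of "M / 2" q] distrib_left[of "e / 2" "(norm (w - x0))\<^sup>2"] by linarith
    also have "\<dots> = (M / 2 * N + e / 2) * (norm (y - w))\<^sup>2 - inner v (y - w)"
      by (simp add: v_def inner_diff_left algebra_simps)
    finally show "inner v (y - w) \<le> (M / 2 * N + e / 2) * (norm (y - w))\<^sup>2" by simp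
  qed
  moreover have "norm ((\<Sum>a\<in>A. c a *\<^sub>R u a) + v) \<le> e"
  proof -
    have "c a *\<^sub>R u a = - M *\<^sub>R (x a - w)" for a
      using c[of a] by (simp add: u_def)
    then have "(\<Sum>a\<in>A. c a *\<^sub>R u a) = - M *\<^sub>R (\<Sum>a\<in>A. x a - w)"
      by (simp add: scaleR_sum_right[symmetric] sum_negf)
    then have "(\<Sum>a\<in>A. c a *\<^sub>R u a) + v = - (e *\<^sub>R (w - x0))"
      by (simp add: v_def)
    then show ?thesis using w1 e by simp
  qed
  moreover have "w \<in> cball x0 2" using w(2) by simp
  ultimately show ?thesis
    using c c1 x2 prox ubound w(1) by (intro exI[of _ c] exI[of _ x] exI[of _ u] exI[of _ w] exI[of _ v]) (auto intro: less_imp_le)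
qed

section \<open>Multipliers at infinity\<close>

lemma bounded_family_convergent_subsequence:
  fixes X :: "nat \<Rightarrow> 'b \<Rightarrow> 'c::heine_borel"
  assumes "finite A" and "\<And>a. a \<in> A \<Longrightarrow> bounded (range (\<lambda>k. X k a))"
  shows "\<exists>r l. strict_mono (r :: nat \<Rightarrow> nat) \<and> (\<forall>a\<in>A. (\<lambda>k. X (r k) a) \<longlonglongrightarrow> l a)"
  using assms
proof (induction A rule: finite_induct)
  case empty
  then show ?case by (auto intro: exI[of _ id] simp: strict_mono_def)
next
  case (insert b A)
  obtain r l where r: "strict_mono (r :: nat \<Rightarrow> nat)" "\<And>a. a \<in> A \<Longrightarrow> (\<lambda>k. X (r k) a) \<longlonglongrightarrow> l a"
    using insert.IH insert.prems by auto
  have "bounded (range (\<lambda>k. X (r k) b))"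
    using insert.prems[of b] by (rule bounded_subset) auto
  then obtain s m where s: "strict_mono (s :: nat \<Rightarrow> nat)" "((\<lambda>k. X (r k) b) \<circ> s) \<longlonglongrightarrow> m"
    using bounded_imp_convergent_subsequence by blast
  have "(\<lambda>k. X ((r \<circ> s) k) a) \<longlonglongrightarrow> l a" if "a \<in> A" for a
    using LIMSEQ_subseq_LIMSEQ[OF r(2)[OF that] s(1)] by (simp add: o_def)
  with s(2) insert.hyps(2) have "\<forall>a\<in>insert b A. (\<lambda>k. X ((r \<circ> s) k) a) \<longlonglongrightarrow> (l(b := m)) a"
    by (auto simp: o_def)
  then show ?case using strict_mono_o[OF r(1) s(1)] by blast
qed

lemma lipschitz_at_infinity_family:
  assumes "finite A" "\<And>a. a \<in> A \<Longrightarrow> lipschitz_at_infinity (h a)"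
  shows "\<exists>L>0. \<exists>R>0. \<forall>a\<in>A. \<forall>x y. norm x > R \<longrightarrow> norm y > R \<longrightarrow> \<bar>h a x - h a y\<bar> \<le> L * norm (x - y)"
  using assms
proof (induction A rule: finite_induct)
  case empty
  then show ?case by (auto intro: exI[of _ 1])
next
  case (insert b A)
  obtain L R where LR: "L > 0" "R > 0"
    "\<And>a x y. a \<in> A \<Longrightarrow> norm x > R \<Longrightarrow> norm y > R \<Longrightarrow> \<bar>h a x - h a y\<bar> \<le> L * norm (x - y)"
    using insert.IH insert.prems by (metis insertCI)
  obtain L' R' where LR': "L' > 0" "R' > 0"
    "\<And>x y. norm x > R' \<Longrightarrow> norm y > R' \<Longrightarrow> \<bar>h b x - h b y\<bar> \<le> L' * norm (x - y)"
    using insert.prems[of b] by (auto simp: lipschitz_at_infinity_def)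
  have "\<bar>h a x - h a y\<bar> \<le> max L L' * norm (x - y)"
    if "a \<in> insert b A" "norm x > max R R'" "norm y > max R R'" for a x y
  proof -
    have "\<bar>h a x - h a y\<bar> \<le> L * norm (x - y) \<or> \<bar>h a x - h a y\<bar> \<le> L' * norm (x - y)"
      using that LR(3)[of a x y] LR'(3)[of x y] by auto
    moreover have "L * norm (x - y) \<le> max L L' * norm (x - y)"
        "L' * norm (x - y) \<le> max L L' * norm (x - y)"
      by (auto intro: mult_right_mono)
    ultimately show ?thesis by linarith
  qed
  then show ?case using LR(1,2) by (intro exI[of _ "max L L'"] exI[of _ "max R R'"] conjI) auto
qed

lemma proximal_subgradient_diff_const:
  "proximal_subgradient (\<lambda>y. h y - c) x u \<longleftrightarrow> proximal_subgradient h x u"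
  by (simp add: proximal_subgradient_def algebra_simps)

lemma filterlim_norm_at_top_cball:
  fixes x y :: "nat \<Rightarrow> 'a::real_normed_vector"
  assumes "filterlim (\<lambda>k. norm (x k)) at_top sequentially" and "\<And>k. y k \<in> cball (x k) C"
  shows "filterlim (\<lambda>k. norm (y k)) at_top sequentially"
proof (rule filterlim_at_top_mono)
  show "filterlim (\<lambda>k. - C + norm (x k)) at_top sequentially"
    by (rule filterlim_tendsto_add_at_top[OF tendsto_const assms(1)])
  show "\<forall>\<^sub>F k in sequentially. - C + norm (x k) \<le> norm (y k)"
  proof (intro always_eventually allI)
    fix k
    show "- C + norm (x k) \<le> norm (y k)"
      using assms(2)[of k] norm_triangle_sub[of "x k" "y k"] by (simp add: dist_norm)
  qed
qed

text \<open>
  The constants \<open>c\<close> in the last hypothesis may change from point to point: they shift the functions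
  \<open>h a\<close> so that the maximum of \<open>h a - c a\<close> is nonnegative on \<open>\<Omega>\<close> and at most \<open>e\<close> at \<open>x\<close>, and shifts
  do not affect subgradients. With \<open>x\<close> tending to infinity and \<open>e\<close> to zero, the approximate
  multipliers have a convergent subsequence: the weights lie in the unit interval, the subgradients
  are bounded by the Lipschitz constant, and the normals are determined by both up to an error that
  vanishes.
\<close>

theorem multipliers_at_infinity:
  fixes h :: "'b \<Rightarrow> 'a::euclidean_space \<Rightarrow> real"
  assumes "finite A" and "closed \<Omega>" and "\<And>a. a \<in> A \<Longrightarrow> lipschitz_at_infinity (h a)"
    and far: "\<And>R e. e > 0 \<Longrightarrow> \<exists>x\<in>\<Omega>. \<exists>c. norm x > R \<and> (\<forall>a\<in>A. h a x \<le> c a + e) \<and>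
      (\<forall>w\<in>\<Omega>. \<exists>a\<in>A. c a \<le> h a w)"
  shows "\<exists>\<mu> u v. (\<forall>a\<in>A. 0 \<le> \<mu> a \<and> u a \<in> subdifferential_at_infinity (h a)) \<and> sum \<mu> A = 1 \<and>
      v \<in> normal_cone_at_infinity \<Omega> \<and> (\<Sum>a\<in>A. \<mu> a *\<^sub>R u a) + v = 0"
proof -
  obtain L R where LR: "L > 0" "R > 0"
    "\<And>a x y. a \<in> A \<Longrightarrow> norm x > R \<Longrightarrow> norm y > R \<Longrightarrow> \<bar>h a x - h a y\<bar> \<le> L * norm (x - y)"
    using lipschitz_at_infinity_family[of A h, OF assms(1,3)] by metis
  define P where "P = (\<lambda>(k :: nat) x0 \<mu> x u w v. norm x0 > real k \<and>
      (\<forall>a\<in>A. 0 \<le> \<mu> a) \<and> sum \<mu> A = 1 \<and>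
      (\<forall>a\<in>A. x a \<in> cball x0 2 \<and> proximal_subgradient (h a) (x a) (u a) \<and> norm (u a) \<le> L) \<and>
      w \<in> \<Omega> \<and> w \<in> cball x0 2 \<and> v \<in> frechet_normal_cone \<Omega> w \<and>
      norm ((\<Sum>a\<in>A. \<mu> a *\<^sub>R u a) + v) \<le> 1 / real (Suc k))"
  have "\<exists>x0 \<mu> x u w v. P k x0 \<mu> x u w v" for k
  proof -
    define e where "e = 1 / real (Suc k)"
    have e: "0 < e" "e \<le> 1" by (auto simp: e_def)
    have "e / 4 > 0" using e by simp
    from far[OF this, of "R + 2 + real k"]
    \<comment> \<open>The margin 2 keeps the whole ball around \<open>x0\<close> in the region where all \<open>h a\<close> are Lipschitz.\<close>
    obtain x0 c where x0: "x0 \<in> \<Omega>" "norm x0 > R + 2 + real k" "\<And>a. a \<in> A \<Longrightarrow> h a x0 \<le> c a + e / 4"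
      "\<And>w. w \<in> \<Omega> \<Longrightarrow> \<exists>a\<in>A. c a \<le> h a w"
      by blast
    have R: "norm y > R" if "y \<in> cball x0 2" for y
      using that x0(2) norm_triangle_sub[of x0 y] by (simp add: dist_norm)
    have "\<exists>\<mu> x u w v. (\<forall>a\<in>A. 0 \<le> \<mu> a) \<and> sum \<mu> A = 1 \<and>
      (\<forall>a\<in>A. x a \<in> cball x0 2 \<and> proximal_subgradient (\<lambda>y. h a y - c a) (x a) (u a) \<and> norm (u a) \<le> L) \<and>
      w \<in> \<Omega> \<and> w \<in> cball x0 2 \<and> v \<in> frechet_normal_cone \<Omega> w \<and>
      norm ((\<Sum>a\<in>A. \<mu> a *\<^sub>R u a) + v) \<le> e"
    proof (rule approximate_multiplier_rule[OF assms(1,2) x0(1) e LR(1)])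
      show "\<bar>h a x - c a - (h a y - c a)\<bar> \<le> L * norm (x - y)"
        if "a \<in> A" "x \<in> cball x0 2" "y \<in> cball x0 2" for a x y
        using LR(3)[OF that(1) R[OF that(2)] R[OF that(3)]] by simp
      show "h a x0 - c a \<le> e / 4" if "a \<in> A" for a using x0(3)[OF that] by simp
      show "\<exists>a\<in>A. 0 \<le> h a w - c a" if "w \<in> \<Omega>" for w using x0(4)[OF that] by auto
    qed
    moreover have "norm x0 > real k" using x0(2) LR(2) by simp
    ultimately show ?thesis
      unfolding P_def proximal_subgradient_diff_const e_def by blast
  qed
  then obtain x0 \<mu> x u w v where "\<And>k. P k (x0 k) (\<mu> k) (x k) (u k) (w k) (v k)"
    by metis
  note * = this[unfolded P_def]
  define X where "X = (\<lambda>k a. (\<mu> k a, u k a))"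
  have bdd: "bounded (range (\<lambda>k. X k a))" if "a \<in> A" for a
  proof -
    have "X k a \<in> {0..1} \<times> cball 0 L" for k
    proof -
      have "\<mu> k a \<le> sum (\<mu> k) A"
        using *[of k] assms(1) that by (intro member_le_sum) auto
      then show ?thesis using *[of k] that by (auto simp: X_def)
    qed
    then have "range (\<lambda>k. X k a) \<subseteq> {0..1} \<times> cball 0 L" by blast
    then show ?thesis by (rule bounded_subset[rotated]) (auto intro: bounded_Times)
  qed
  obtain r l where r: "strict_mono (r :: nat \<Rightarrow> nat)" "\<And>a. a \<in> A \<Longrightarrow> (\<lambda>k. X (r k) a) \<longlonglongrightarrow> l a"
    using bounded_family_convergent_subsequence[of A X, OF assms(1) bdd] by blast
  define m where "m = (\<lambda>a. fst (l a))"
  define z where "z = (\<lambda>a. snd (l a))"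
  have m: "(\<lambda>k. \<mu> (r k) a) \<longlonglongrightarrow> m a" if "a \<in> A" for a
    using tendsto_fst[OF r(2)[OF that]] by (simp add: X_def m_def)
  have z: "(\<lambda>k. u (r k) a) \<longlonglongrightarrow> z a" if "a \<in> A" for a
    using tendsto_snd[OF r(2)[OF that]] by (simp add: X_def z_def)
  have x0: "filterlim (\<lambda>k. norm (x0 (r k))) at_top sequentially"
  proof (rule filterlim_at_top_mono)
    show "filterlim (\<lambda>k. real (r k)) at_top sequentially"
      using filterlim_compose[OF filterlim_real_sequentially filterlim_subseq[OF r(1)]] .
    show "\<forall>\<^sub>F k in sequentially. real (r k) \<le> norm (x0 (r k))"
      using * by (intro always_eventually allI) (simp add: less_imp_le)
  qed
  have m0: "0 \<le> m a" if "a \<in> A" for a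
    using LIMSEQ_le_const[OF m[OF that], of 0] * that by auto
  have m1: "sum m A = 1"
  proof -
    have "(\<lambda>k. sum (\<mu> (r k)) A) \<longlonglongrightarrow> sum m A" by (intro tendsto_sum m)
    then show ?thesis using * by (simp add: LIMSEQ_const_iff)
  qed
  have zsub: "z a \<in> subdifferential_at_infinity (h a)" if a: "a \<in> A" for a
  proof -
    have "filterlim (\<lambda>k. norm (x (r k) a)) at_top sequentially"
      using x0 by (rule filterlim_norm_at_top_cball) (use * a in blast)
    moreover have "\<forall>k. (u (r k) a, -1) \<in> limiting_normal_cone (epigraph UNIV (h a)) (x (r k) a, h a (x (r k) a))"
      using * a proximal_subgradient_imp_epigraph_normal by blast
    moreover have "(\<lambda>k. (u (r k) a, -1 :: real)) \<longlonglongrightarrow> (z a, -1)"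
      by (intro tendsto_Pair z a tendsto_const)
    ultimately show ?thesis unfolding subdifferential_at_infinity_def
      by (intro CollectI exI[of _ "\<lambda>k. x (r k) a"] exI[of _ "\<lambda>k. (u (r k) a, -1)"]) auto
  qed
  define s where "s = (\<lambda>k. (\<Sum>a\<in>A. \<mu> k a *\<^sub>R u k a) + v k)"
  have "s \<longlonglongrightarrow> 0"
  proof (rule Lim_null_comparison)
    show "\<forall>\<^sub>F k in sequentially. norm (s k) \<le> 1 / real (Suc k)"
      unfolding s_def using * by (intro always_eventually allI) blast
    show "(\<lambda>k. 1 / real (Suc k)) \<longlonglongrightarrow> 0" using LIMSEQ_Suc[OF lim_1_over_n] .
  qed
  then have "(\<lambda>k. s (r k)) \<longlonglongrightarrow> 0"
    using LIMSEQ_subseq_LIMSEQ[OF _ r(1)] by (simp add: o_def)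
  then have "(\<lambda>k. s (r k) - (\<Sum>a\<in>A. \<mu> (r k) a *\<^sub>R u (r k) a)) \<longlonglongrightarrow> 0 - (\<Sum>a\<in>A. m a *\<^sub>R z a)"
    by (intro tendsto_diff tendsto_sum tendsto_scaleR m z)
  then have "(\<lambda>k. v (r k)) \<longlonglongrightarrow> - (\<Sum>a\<in>A. m a *\<^sub>R z a)"
    by (simp add: s_def)
  moreover have "filterlim (\<lambda>k. norm (w (r k))) at_top sequentially"
    using x0 by (rule filterlim_norm_at_top_cball) (use * in blast)
  ultimately have "- (\<Sum>a\<in>A. m a *\<^sub>R z a) \<in> normal_cone_at_infinity \<Omega>"
    unfolding normal_cone_at_infinity_def using *
    by (intro CollectI exI[of _ "\<lambda>k. w (r k)"] exI[of _ "\<lambda>k. v (r k)"]) blast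
  then show ?thesis using m0 m1 zsub
    by (intro exI[of _ m] exI[of _ z] exI[of _ "- (\<Sum>a\<in>A. m a *\<^sub>R z a)"]) auto
qed

section \<open>Almost minimisers and Pareto points\<close>

text \<open>
  The multipliers at infinity are applied to the combined family of the \<open>f i\<close>, shifted by \<open>c i\<close>, and
  the unshifted \<open>g j\<close>. At an infeasible point of \<open>\<Omega>\<close> some \<open>g j\<close> is positive, which makes the combined
  maximum nonnegative there. Depending on whether the weights of the \<open>f i\<close> sum to zero, the resulting
  relation contradicts one or the other hypothesis.
\<close>

lemma no_far_almost_minimisers:
  fixes f :: "'m::finite \<Rightarrow> 'a::euclidean_space \<Rightarrow> real" and g :: "'j \<Rightarrow> 'a \<Rightarrow> real"
  assumes "closed \<Omega>" "finite J"
    and "\<And>i. lipschitz_at_infinity (f i)" "\<And>j. j \<in> J \<Longrightarrow> lipschitz_at_infinity (g j)"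
    and CQ: "CQ_at_infinity \<Omega> J g"
    and sep: "0 \<notin> convex hull (\<Union>i. subdifferential_at_infinity (f i))
             + pos_comb J (\<lambda>j. subdifferential_at_infinity (g j))
             + normal_cone_at_infinity \<Omega>"
  shows "\<exists>R. \<exists>e>0. \<forall>x c. x \<in> feasible_set \<Omega> J g \<longrightarrow> (\<forall>i. f i x \<le> c i + e) \<longrightarrow>
      (\<forall>w\<in>feasible_set \<Omega> J g. \<exists>i. c i \<le> f i w) \<longrightarrow> norm x \<le> R"
proof (rule ccontr)
  assume contra: "\<not> ?thesis"
  define A where "A = (UNIV :: 'm set) <+> J"
  define h where "h = case_sum f g"
  have "finite A" using \<open>finite J\<close> by (simp add: A_def)
  moreover have "lipschitz_at_infinity (h a)" if "a \<in> A" for a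
    using that assms(3,4) by (auto simp: A_def h_def)
  moreover have "\<exists>x\<in>\<Omega>. \<exists>c. norm x > R \<and> (\<forall>a\<in>A. h a x \<le> c a + e) \<and> (\<forall>w\<in>\<Omega>. \<exists>a\<in>A. c a \<le> h a w)"
    if "e > 0" for R e
  proof -
    have "\<not> (\<forall>x c. x \<in> feasible_set \<Omega> J g \<longrightarrow> (\<forall>i. f i x \<le> c i + e) \<longrightarrow>
        (\<forall>w\<in>feasible_set \<Omega> J g. \<exists>i. c i \<le> f i w) \<longrightarrow> norm x \<le> R)"
      using contra that by blast
    then obtain x c where x: "x \<in> feasible_set \<Omega> J g" "\<forall>i. f i x \<le> c i + e"
        "\<forall>w\<in>feasible_set \<Omega> J g. \<exists>i. c i \<le> f i w" "norm x > R"
      unfolding not_all not_imp not_le by blast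
    have "\<exists>a\<in>A. case_sum c (\<lambda>_. 0) a \<le> h a w" if w: "w \<in> \<Omega>" for w
    proof (cases "w \<in> feasible_set \<Omega> J g")
      case True
      then obtain i where "c i \<le> f i w" using x(3) by blast
      then show ?thesis by (intro bexI[of _ "Inl i"]) (auto simp: A_def h_def)
    next
      case False
      then obtain j where "j \<in> J" "0 \<le> g j w" using w by (force simp: feasible_set_def not_le)
      then show ?thesis by (intro bexI[of _ "Inr j"]) (auto simp: A_def h_def)
    qed
    moreover have "h a x \<le> case_sum c (\<lambda>_. 0) a + e" if "a \<in> A" for a
      using that x(1,2) \<open>e > 0\<close> by (force simp: A_def h_def feasible_set_def)
    moreover have "x \<in> \<Omega>" using x(1) by (simp add: feasible_set_def)
    ultimately show ?thesis using x(4) by blast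
  qed
  ultimately have "\<exists>\<mu> u v. (\<forall>a\<in>A. 0 \<le> \<mu> a \<and> u a \<in> subdifferential_at_infinity (h a)) \<and> sum \<mu> A = 1 \<and>
      v \<in> normal_cone_at_infinity \<Omega> \<and> (\<Sum>a\<in>A. \<mu> a *\<^sub>R u a) + v = 0"
    using \<open>closed \<Omega>\<close> by (intro multipliers_at_infinity)
  then obtain \<mu> u v where \<mu>u: "\<forall>a\<in>A. 0 \<le> \<mu> a \<and> u a \<in> subdifferential_at_infinity (h a)"
      and \<mu>1: "sum \<mu> A = 1" and v: "v \<in> normal_cone_at_infinity \<Omega>"
      and zero: "(\<Sum>a\<in>A. \<mu> a *\<^sub>R u a) + v = 0"
    by (elim exE conjE)
  define S where "S = (\<Sum>i\<in>UNIV. \<mu> (Inl i))"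
  have S1: "S + (\<Sum>j\<in>J. \<mu> (Inr j)) = 1"
    using \<mu>1 \<open>finite J\<close> by (simp add: A_def sum.Plus S_def)
  have zero': "(\<Sum>i\<in>UNIV. \<mu> (Inl i) *\<^sub>R u (Inl i)) + (\<Sum>j\<in>J. \<mu> (Inr j) *\<^sub>R u (Inr j)) + v = 0"
    using zero \<open>finite J\<close> by (simp add: A_def sum.Plus)
  have Inl: "0 \<le> \<mu> (Inl i)" "u (Inl i) \<in> subdifferential_at_infinity (f i)" for i
    using \<mu>u[rule_format, of "Inl i"] by (auto simp: A_def h_def)
  have Inr: "0 \<le> \<mu> (Inr j)" "u (Inr j) \<in> subdifferential_at_infinity (g j)" if "j \<in> J" for j
    using \<mu>u[rule_format, of "Inr j"] that by (auto simp: A_def h_def)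
  have "S \<ge> 0" unfolding S_def by (intro sum_nonneg Inl)
  show False
  proof (cases "S = 0")
    case True
    then have "\<mu> (Inl i) = 0" for i
      using Inl(1) by (simp add: S_def sum_nonneg_eq_0_iff)
    then have "0 = (\<Sum>j\<in>J. \<mu> (Inr j) *\<^sub>R u (Inr j)) + v" using zero' by simp
    moreover have "(\<Sum>j\<in>J. \<mu> (Inr j) *\<^sub>R u (Inr j)) \<in>
        (\<Sum>j\<in>J. (\<lambda>v. \<mu> (Inr j) *\<^sub>R v) ` subdifferential_at_infinity (g j))"
      unfolding set_sum_alt[OF \<open>finite J\<close>]
      using Inr(2) by (intro CollectI exI[of _ "\<lambda>j. \<mu> (Inr j) *\<^sub>R u (Inr j)"]) auto
    ultimately have "0 \<in> (\<Sum>j\<in>J. (\<lambda>v. \<mu> (Inr j) *\<^sub>R v) ` subdifferential_at_infinity (g j))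
        + normal_cone_at_infinity \<Omega>"
      using v set_plus_intro by metis
    then have "\<exists>\<beta>. (\<forall>j\<in>J. 0 \<le> \<beta> j) \<and> sum \<beta> J > 0 \<and>
        0 \<in> (\<Sum>j\<in>J. (\<lambda>v. \<beta> j *\<^sub>R v) ` subdifferential_at_infinity (g j)) + normal_cone_at_infinity \<Omega>"
      using S1 True Inr(1) by (intro exI[of _ "\<lambda>j. \<mu> (Inr j)"] conjI ballI) simp_all
    then show False using CQ unfolding CQ_at_infinity_def by (rule notE[rotated])
  next
    case False
    then have S: "S > 0" using \<open>S \<ge> 0\<close> by simp
    have "(\<Sum>i\<in>UNIV. (\<mu> (Inl i) / S) *\<^sub>R u (Inl i)) \<in> convex hull (\<Union>i. subdifferential_at_infinity (f i))"
    proof (rule convex_sum)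
      show "(\<Sum>i\<in>UNIV. \<mu> (Inl i) / S) = 1"
        using S by (simp add: sum_divide_distrib[symmetric] S_def)
      show "u (Inl i) \<in> convex hull (\<Union>i. subdifferential_at_infinity (f i))" for i
        using Inl(2)[of i] by (intro hull_inc) blast
    qed (use S Inl(1) in auto)
    moreover have "(\<Sum>j\<in>J. (\<mu> (Inr j) / S) *\<^sub>R u (Inr j)) \<in> pos_comb J (\<lambda>j. subdifferential_at_infinity (g j))"
      unfolding pos_comb_def using Inr S
      by (intro CollectI exI[of _ "\<lambda>j. \<mu> (Inr j) / S"] exI[of _ "\<lambda>j. u (Inr j)"]) auto
    moreover have "(1 / S) *\<^sub>R v \<in> normal_cone_at_infinity \<Omega>"
      using normal_cone_at_infinity_scaleR[OF v, of "1 / S"] S by simp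
    ultimately have sum_in: "(\<Sum>i\<in>UNIV. (\<mu> (Inl i) / S) *\<^sub>R u (Inl i))
        + (\<Sum>j\<in>J. (\<mu> (Inr j) / S) *\<^sub>R u (Inr j)) + (1 / S) *\<^sub>R v
        \<in> convex hull (\<Union>i. subdifferential_at_infinity (f i))
          + pos_comb J (\<lambda>j. subdifferential_at_infinity (g j)) + normal_cone_at_infinity \<Omega>"
      by (intro set_plus_intro)
    have sum_0: "(\<Sum>i\<in>UNIV. (\<mu> (Inl i) / S) *\<^sub>R u (Inl i)) + (\<Sum>j\<in>J. (\<mu> (Inr j) / S) *\<^sub>R u (Inr j))
        + (1 / S) *\<^sub>R v = (1 / S) *\<^sub>R 0"
      unfolding zero'[symmetric] by (simp add: scaleR_add_right scaleR_sum_right)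
    show False using sep sum_in unfolding sum_0 scaleR_zero_right by (rule notE)
  qed
qed

lemma pareto_value_not_dominated:
  assumes "y \<in> pareto_values f F" "w \<in> F" "\<And>i. f w $ i \<le> y $ i"
  shows "f w = y"
proof (rule ccontr)
  assume "f w \<noteq> y"
  then have "y - f w \<in> nonneg_orthant - {0}"
    using assms(3) by (auto simp: nonneg_orthant_def)
  then have "f w \<in> (\<lambda>z. y - z) ` (nonneg_orthant - {0})"
    by (intro image_eqI[of _ _ "y - f w"]) auto
  then show False using assms(1,2) unfolding pareto_values_def by blast
qed

lemma pareto_value_weak:
  assumes "y \<in> pareto_values f F" "w \<in> F"
  shows "\<exists>i. y $ i \<le> f w $ i"
proof (rule ccontr)
  assume "\<not> ?thesis"
  then have "f w $ i < y $ i" for i by (simp add: not_le)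
  then show False using pareto_value_not_dominated[OF assms] by (metis less_irrefl less_imp_le)
qed

lemma lower_semicontinuous_limit_le:
  assumes "lower_semicontinuous h" "x \<longlonglongrightarrow> l" "b \<longlonglongrightarrow> c" "\<And>k. h (x k) \<le> b k"
  shows "h l \<le> c"
proof (rule ccontr)
  assume "\<not> h l \<le> c"
  then obtain a where a: "c < a" "a < h l" using dense not_le by blast
  then have "\<forall>\<^sub>F y in nhds l. a < h y"
    using assms(1) unfolding lower_semicontinuous_def by blast
  then have "\<forall>\<^sub>F k in sequentially. a < h (x k)"
    using assms(2) by (rule eventually_compose_filterlim)
  moreover have "\<forall>\<^sub>F k in sequentially. b k < a"
    using assms(3) a(1) by (rule order_tendstoD)
  ultimately have "\<forall>\<^sub>F k in sequentially. False"
    by eventually_elim (use assms(4) in \<open>meson less_trans not_le\<close>)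
  then show False by simp
qed

theorem theorem4p3:
  fixes \<Omega> :: "(real ^ 'n) set"
    and f :: "'m::finite \<Rightarrow> real ^ 'n \<Rightarrow> real"
    and p :: nat
    and g :: "nat \<Rightarrow> real ^ 'n \<Rightarrow> real"
  assumes "closed \<Omega>" and "\<Omega> \<noteq> {}"
    and "\<And>i. lower_semicontinuous (f i)"
    and "\<And>i. lipschitz_at_infinity (f i)"
    and "\<And>j. j \<in> {1..p} \<Longrightarrow> lower_semicontinuous (g j)"
    and "\<And>j. j \<in> {1..p} \<Longrightarrow> lipschitz_at_infinity (g j)"
    and "feasible_set \<Omega> {1..p} g \<noteq> {}"
    and "\<not> bounded (feasible_set \<Omega> {1..p} g)"
    and "bdd_below ((\<lambda>x. MAX i. f i x) ` feasible_set \<Omega> {1..p} g)"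
    and "pareto_values (\<lambda>x. \<chi> i. f i x) (feasible_set \<Omega> {1..p} g) \<noteq> {}"
    and "CQ_at_infinity \<Omega> {1..p} g"
    and "0 \<notin> convex hull (\<Union>i. subdifferential_at_infinity (f i))
             + pos_comb {1..p} (\<lambda>j. subdifferential_at_infinity (g j))
             + normal_cone_at_infinity \<Omega>"
  shows "pareto_solutions (\<lambda>x. \<chi> i. f i x) (feasible_set \<Omega> {1..p} g) \<noteq> {}
         \<and> bounded (pareto_solutions (\<lambda>x. \<chi> i. f i x) (feasible_set \<Omega> {1..p} g))"
proof -
  let ?F = "feasible_set \<Omega> {1..p} g"
  let ?f = "\<lambda>x. \<chi> i. f i x"
  obtain R e where e: "e > 0"
    and far': "\<forall>x c. x \<in> ?F \<longrightarrow> (\<forall>i. f i x \<le> c i + e) \<longrightarrow> (\<forall>w\<in>?F. \<exists>i. c i \<le> f i w) \<longrightarrow> norm x \<le> R"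
    using no_far_almost_minimisers[OF assms(1) finite_atLeastAtMost assms(4,6,11,12)] by blast
  have far: "\<And>x c. x \<in> ?F \<Longrightarrow> (\<And>i. f i x \<le> c i + e) \<Longrightarrow> (\<And>w. w \<in> ?F \<Longrightarrow> \<exists>i. c i \<le> f i w) \<Longrightarrow> norm x \<le> R"
    using far' by blast
  have weak: "\<exists>i. y $ i \<le> f i w" if "y \<in> pareto_values ?f ?F" "w \<in> ?F" for y w
    using pareto_value_weak[OF that] by simp
  have "norm x \<le> R" if "x \<in> pareto_solutions ?f ?F" for x
  proof (rule far[where c = "\<lambda>i. f i x"])
    show "x \<in> ?F" using that by (simp add: pareto_solutions_def)
    show "f i x \<le> f i x + e" for i using e by simp
    show "\<exists>i. f i x \<le> f i w" if "w \<in> ?F" for w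
      using weak[OF _ that, of "?f x"] \<open>x \<in> pareto_solutions ?f ?F\<close> by (simp add: pareto_solutions_def)
  qed
  then have "bounded (pareto_solutions ?f ?F)" by (auto simp: bounded_iff)
  moreover have "pareto_solutions ?f ?F \<noteq> {}"
  proof -
    obtain y where y: "y \<in> pareto_values ?f ?F" using assms(10) by blast
    then have "y \<in> closure (?f ` ?F)" by (simp add: pareto_values_def)
    then obtain ys where ys: "\<And>k. ys k \<in> ?f ` ?F" "ys \<longlonglongrightarrow> y"
      unfolding closure_sequential by blast
    then obtain x where x: "\<And>k. x k \<in> ?F" "\<And>k. ys k = ?f (x k)"
      unfolding image_iff by metis
    have lim: "(\<lambda>k. f i (x k)) \<longlonglongrightarrow> y $ i" for i
      using tendsto_vec_nth[OF ys(2), of i] by (simp add: x(2))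
    \<comment> \<open>From some index on the points \<open>x k\<close> are almost minimisers for the shifts \<open>y $ i\<close>, hence bounded.\<close>
    have "\<forall>\<^sub>F k in sequentially. \<forall>i. f i (x k) < y $ i + e"
    proof (rule eventually_all_finite)
      show "\<forall>\<^sub>F k in sequentially. f i (x k) < y $ i + e" for i
        using lim[of i] e by (intro order_tendstoD(2)[where y = "y $ i"]) auto
    qed
    then obtain K where K: "\<And>k i. k \<ge> K \<Longrightarrow> f i (x k) < y $ i + e"
      by (auto simp: eventually_sequentially)
    have "norm (x (k + K)) \<le> R" for k
      using K[OF le_add2] weak[OF y] by (intro far[where c = "\<lambda>i. y $ i"] x(1)) (auto intro: less_imp_le)
    then have "bounded (range (\<lambda>k. x (k + K)))" by (auto simp: bounded_iff)
    then obtain r l where r: "strict_mono (r :: nat \<Rightarrow> nat)" "((\<lambda>k. x (k + K)) \<circ> r) \<longlonglongrightarrow> l"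
      using bounded_imp_convergent_subsequence by blast
    then have l: "(\<lambda>k. x (r k + K)) \<longlonglongrightarrow> l" by (simp add: o_def)
    have "l \<in> \<Omega>"
      using assms(1) l x(1) by (rule_tac closed_sequentially) (auto simp: feasible_set_def)
    moreover have "g j l \<le> 0" if "j \<in> {1..p}" for j
      using x(1) that
      by (intro lower_semicontinuous_limit_le[OF assms(5)[OF that] l tendsto_const])
         (auto simp: feasible_set_def)
    ultimately have "l \<in> ?F" by (simp add: feasible_set_def)
    have "f i l \<le> y $ i" for i
    proof (rule lower_semicontinuous_limit_le[OF assms(3) l])
      show "(\<lambda>k. f i (x (r k + K))) \<longlonglongrightarrow> y $ i"
        using LIMSEQ_subseq_LIMSEQ[OF LIMSEQ_ignore_initial_segment[where k = K, OF lim] r(1)]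
        by (simp add: o_def)
    qed simp
    then have "?f l = y"
      using pareto_value_not_dominated[OF y \<open>l \<in> ?F\<close>] by simp
    then show ?thesis using y \<open>l \<in> ?F\<close> by (auto simp: pareto_solutions_def)
  qed
  ultimately show ?thesis by blast
qed

end
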